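(* (Lifting Criterion) Let $(\widetilde{X},\rho)$ be a covering graph of a graph $X$, let $f:(Y,y_0)\to(X,x_0)$ be a graph homomorphism with $Y$ a connected graph, and let $\widetilde{x}_0\in\rho^{-1}(x_0)$. If $X$ contains neither 3-cycles nor 4-cycles, then there is a lift $\widetilde{f}:(Y,y_0)\to(\widetilde{X},\widetilde{x}_0)$ of $f$ if and only if $f_\ast(A_1(Y,y_0))\subseteq\rho_\ast(A_1(\widetilde{X},\widetilde{x}_0))$.
   Context: Graphs: every graph $X$ is a simple graph (possibly infinite) with a loop attached at every vertex, with vertex set $V(X)$ and edge set $E(X)$; $v,w$ are adjacent if $vw\in E(X)$, so every vertex is adjacent to itself. A graph homomorphism $f:X\to Y$ is a map $V(X)\to V(Y)$ with $f(u)f(v)\in E(Y)$ whenever $uv\in E(X)$. $(X,x_0)$ denotes a graph with distinguished vertex $x_0$, and a graph homomorphism $f:(X,x_0)\to(Y,y_0)$ satisfies $f(x_0)=y_0$. "Neither 3-cycles nor 4-cycles" means that $X$ contains no cycle on 3 or 4 distinct vertices as a (not necessarily induced) subgraph. Stable homomorphisms: $I_\infty$ is the graph with vertex set $\mathbb{Z}$ in which $i,j$ are adjacent iff $|i-j|\le1$. $I_\infty^2$ is the graph on $\mathbb{Z}^2$ in which $(a,b),(a',b')$ are adjacent iff ($a=a'$ and $|b-b'|\le1$) or ($b=b'$ and $|a-a'|\le1$). A graph homomorphism $f:I_\infty^n\to X$ ($n=1,2$) stabilizes in direction $+i$ if there is an integer $p$ such that, for all values of the other coordinates, the value of $f$ with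 $i$-th coordinate $m$ equals that with $i$-th coordinate $p$ for all $m\ge p$; it stabilizes in direction $-i$ if there is an integer $q$ with the same property for all $m\le q$. $p_f^i$ is the least such $p$ and $n_f^i$ the greatest such $q$ (if $f$ does not depend on the $i$-th coordinate, $p_f^i=n_f^i=0$). $f$ is stable if it stabilizes in all directions; $S_n(X)$ is the set of stable graph homomorphisms $I_\infty^n\to X$. A graph $X$ is connected if for all $v,w\in V(X)$ there is $f\in S_1(X)$ with $f(n_f^1)=v$ and $f(p_f^1)=w$. Fundamental group: $f,g\in S_1(X)$ are path homotopic, $f\sim g$, if there is $H\in S_2(X)$ (a path homotopy from $f$ to $g$) such that (a) $f(p_f^1)=g(p_g^1)$ and $f(n_f^1)=g(n_g^1)$; (b) $H(p_H^1,j)=f(p_f^1)$ and $H(n_H^1,j)=f(n_f^1)$ for all $j\in\mathbb{Z}$; (c) $H(j,n_H^2)=f(j)$ and $H(j,p_H^2)=g(j)$ for all $j\in\mathbb{Z}$. This is an equivalence relation. $B_1(X,x_0)$ is the set of $f\in S_1(X)$ with $f(n_f^1)=f(p_f^1)=x_0$, and $A_1(X,x_0)=B_1(X,x_0)/\sim$ is the fundamental group, with operation induced by concatenation. For a graph homomorphism $f:(Y,y_0)\to(X,x_0)$, the induced map $f_\ast:A_1(Y,y_0)\to A_1(X,x_0)$ is $f_\ast([\gamma])=[f\circ\gamma]$. Coverings: let $N[x]=\{v\in V(X) : vx\in E(X)\}$. A graph homomorphism $\rho:X\to Y$ is a local isomorphism if for each $y\in V(Y)$ and each $x\in\rho^{-1}(y)$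 the restriction $\rho|_{N[x]}:N[x]\to N[y]$ is bijective. $(\widetilde{X},\rho)$ with $\rho:\widetilde{X}\to X$ a graph homomorphism is a covering graph of $X$ if $\rho$ is a surjective local isomorphism. A lift $\widetilde f:(Y,y_0)\to(\widetilde X,\widetilde x_0)$ of $f$ is a graph homomorphism with $\rho\circ\widetilde f=f$ and $\widetilde f(y_0)=\widetilde x_0$. *)

theory Defs
  imports "HOL-Algebra.Group"
begin

section \<open>Graphs with a loop at every vertex\<close>

text \<open>Edges are kept as a symmetric relation, so the undirected edge $vw$ is present as both
  ordered pairs.\<close>

record 'a graph =
  verts :: "'a set"
  edges :: "('a \<times> 'a) set"

definition refl_graph :: "'a graph \<Rightarrow> bool" where
  "refl_graph X \<longleftrightarrow>
     edges X \<subseteq> verts X \<times> verts X \<and> sym (edges X) \<and> refl_on (verts X) (edges X)"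

definition nbhd :: "'a graph \<Rightarrow> 'a \<Rightarrow> 'a set" where
  "nbhd X x = {v \<in> verts X. (v, x) \<in> edges X}"

definition graph_hom :: "'a graph \<Rightarrow> 'b graph \<Rightarrow> ('a \<Rightarrow> 'b) \<Rightarrow> bool" where
  "graph_hom X Y f \<longleftrightarrow>
     f ` verts X \<subseteq> verts Y \<and> (\<forall>(u, v) \<in> edges X. (f u, f v) \<in> edges Y)"

definition pointed_hom :: "'a graph \<Rightarrow> 'a \<Rightarrow> 'b graph \<Rightarrow> 'b \<Rightarrow> ('a \<Rightarrow> 'b) \<Rightarrow> bool" where
  "pointed_hom X x0 Y y0 f \<longleftrightarrow>
     x0 \<in> verts X \<and> y0 \<in> verts Y \<and> graph_hom X Y f \<and> f x0 = y0"

text \<open>\<open>c\<close> lists the vertices of the cycle in cyclic order; for \<open>n \<ge> 3\<close> this is the usual notion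
  of an \<open>n\<close>-cycle as a (not necessarily induced) subgraph.\<close>

definition has_cycle :: "nat \<Rightarrow> 'a graph \<Rightarrow> bool" where
  "has_cycle n X \<longleftrightarrow>
     (\<exists>c. length c = n \<and> distinct c \<and> set c \<subseteq> verts X \<and>
        (\<forall>i<n. (c ! i, c ! (Suc i mod n)) \<in> edges X))"

section \<open>Stable homomorphisms\<close>

definition I_inf :: "int graph" where
  "I_inf = \<lparr>verts = UNIV, edges = {(i, j). \<bar>i - j\<bar> \<le> 1}\<rparr>"

definition I_inf2 :: "(int \<times> int) graph" where
  "I_inf2 = \<lparr>verts = UNIV,
     edges = {((a, b), (a', b')). (a = a' \<and> \<bar>b - b'\<bar> \<le> 1) \<or> (b = b' \<and> \<bar>a - a'\<bar> \<le> 1)}\<rparr>"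

text \<open>The following four notions treat one direction of a map on $I_\infty^n$.  Their argument is
  the map seen as a function of the coordinate in question, whose value is a function of the
  remaining coordinates; hence \<open>F m = F p\<close> means equality for all values of these.  For
  \<open>n = 1\<close> there are no remaining coordinates and \<open>F\<close> is the map itself.\<close>

definition stab_pos :: "(int \<Rightarrow> 'c) \<Rightarrow> bool" where
  "stab_pos F \<longleftrightarrow> (\<exists>p. \<forall>m\<ge>p. F m = F p)"

definition stab_neg :: "(int \<Rightarrow> 'c) \<Rightarrow> bool" where
  "stab_neg F \<longleftrightarrow> (\<exists>q. \<forall>m\<le>q. F m = F q)"

definition pos_idx :: "(int \<Rightarrow> 'c) \<Rightarrow> int" where
  "pos_idx F = (if \<forall>m m'. F m = F m' then 0 else LEAST p. \<forall>m\<ge>p. F m = F p)"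

definition neg_idx :: "(int \<Rightarrow> 'c) \<Rightarrow> int" where
  "neg_idx F = (if \<forall>m m'. F m = F m' then 0 else GREATEST q. \<forall>m\<le>q. F m = F q)"

definition dir1 :: "(int \<times> int \<Rightarrow> 'a) \<Rightarrow> int \<Rightarrow> int \<Rightarrow> 'a" where
  "dir1 H = (\<lambda>a b. H (a, b))"

definition dir2 :: "(int \<times> int \<Rightarrow> 'a) \<Rightarrow> int \<Rightarrow> int \<Rightarrow> 'a" where
  "dir2 H = (\<lambda>b a. H (a, b))"

definition S1 :: "'a graph \<Rightarrow> (int \<Rightarrow> 'a) set" where
  "S1 X = {f. graph_hom I_inf X f \<and> stab_pos f \<and> stab_neg f}"

definition S2 :: "'a graph \<Rightarrow> (int \<times> int \<Rightarrow> 'a) set" where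
  "S2 X = {H. graph_hom I_inf2 X H \<and>
     stab_pos (dir1 H) \<and> stab_neg (dir1 H) \<and> stab_pos (dir2 H) \<and> stab_neg (dir2 H)}"

definition connected_graph :: "'a graph \<Rightarrow> bool" where
  "connected_graph X \<longleftrightarrow>
     (\<forall>v\<in>verts X. \<forall>w\<in>verts X. \<exists>f\<in>S1 X. f (neg_idx f) = v \<and> f (pos_idx f) = w)"

section \<open>The fundamental group\<close>

definition is_path_homotopy ::
  "'a graph \<Rightarrow> (int \<Rightarrow> 'a) \<Rightarrow> (int \<Rightarrow> 'a) \<Rightarrow> (int \<times> int \<Rightarrow> 'a) \<Rightarrow> bool" where
  "is_path_homotopy X f g H \<longleftrightarrow> H \<in> S2 X \<and>
     f (pos_idx f) = g (pos_idx g) \<and> f (neg_idx f) = g (neg_idx g) \<and>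
     (\<forall>j. H (pos_idx (dir1 H), j) = f (pos_idx f) \<and> H (neg_idx (dir1 H), j) = f (neg_idx f)) \<and>
     (\<forall>j. H (j, neg_idx (dir2 H)) = f j \<and> H (j, pos_idx (dir2 H)) = g j)"

definition path_homotopic :: "'a graph \<Rightarrow> ((int \<Rightarrow> 'a) \<times> (int \<Rightarrow> 'a)) set" where
  "path_homotopic X = {(f, g). f \<in> S1 X \<and> g \<in> S1 X \<and> (\<exists>H. is_path_homotopy X f g H)}"

definition B1 :: "'a graph \<Rightarrow> 'a \<Rightarrow> (int \<Rightarrow> 'a) set" where
  "B1 X x0 = {f \<in> S1 X. f (neg_idx f) = x0 \<and> f (pos_idx f) = x0}"

text \<open>The second path is traversed after the first one; both are shifted so that the first ends,
  and the second starts, at index 0.\<close>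

definition path_concat :: "(int \<Rightarrow> 'a) \<Rightarrow> (int \<Rightarrow> 'a) \<Rightarrow> int \<Rightarrow> 'a" where
  "path_concat f g = (\<lambda>i. if i \<le> 0 then f (i + pos_idx f) else g (i + neg_idx g))"

text \<open>In \<open>A1\<close> and \<open>induced_map\<close>, the union over representatives is the common class they yield.\<close>

definition A1 :: "'a graph \<Rightarrow> 'a \<Rightarrow> (int \<Rightarrow> 'a) set monoid" where
  "A1 X x0 = \<lparr>carrier = B1 X x0 // path_homotopic X,
     mult = (\<lambda>c d. \<Union>f\<in>c. \<Union>g\<in>d. path_homotopic X `` {path_concat f g}),
     one = path_homotopic X `` {\<lambda>_. x0}\<rparr>"

definition induced_map :: "'b graph \<Rightarrow> ('a \<Rightarrow> 'b) \<Rightarrow> (int \<Rightarrow> 'a) set \<Rightarrow> (int \<Rightarrow> 'b) set" where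
  "induced_map X f c = (\<Union>\<gamma>\<in>c. path_homotopic X `` {f \<circ> \<gamma>})"

section \<open>Coverings and lifts\<close>

definition local_isomorphism :: "'a graph \<Rightarrow> 'b graph \<Rightarrow> ('a \<Rightarrow> 'b) \<Rightarrow> bool" where
  "local_isomorphism X Y \<rho> \<longleftrightarrow> graph_hom X Y \<rho> \<and>
     (\<forall>y\<in>verts Y. \<forall>x\<in>verts X. \<rho> x = y \<longrightarrow> bij_betw \<rho> (nbhd X x) (nbhd Y y))"

definition covering_graph :: "'a graph \<Rightarrow> ('a \<Rightarrow> 'b) \<Rightarrow> 'b graph \<Rightarrow> bool" where
  "covering_graph Xt \<rho> X \<longleftrightarrow> local_isomorphism Xt X \<rho> \<and> \<rho> ` verts Xt = verts X"

definition is_lift ::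
  "'c graph \<Rightarrow> 'c \<Rightarrow> 'a graph \<Rightarrow> 'a \<Rightarrow> ('a \<Rightarrow> 'b) \<Rightarrow> ('c \<Rightarrow> 'b) \<Rightarrow> ('c \<Rightarrow> 'a) \<Rightarrow> bool" where
  "is_lift Y y0 Xt xt0 \<rho> f ft \<longleftrightarrow>
     pointed_hom Y y0 Xt xt0 ft \<and> (\<forall>y\<in>verts Y. \<rho> (ft y) = f y)"

end

theory Submission
  imports Defs
begin

text \<open>
  A covering lifts every stable path uniquely once the lift of its starting vertex is fixed,
  because a local isomorphism is bijective on closed neighbourhoods.  The role of the hypothesis on
  cycles is that path homotopies lift as well (\<open>homotopic_lifts_same_end\<close>): a homotopy is a
  grid of squares, each mapped to a closed walk of length four, and without 3-cycles and 4-cycles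
  such a walk degenerates, so that a lift of three of its sides closes up
  (\<open>square_lift\<close>).  Consequently the lifts of two adjacent rows of the grid that start
  at the same vertex stay adjacent column by column.  In the columns far to the right the grid is
  constant, so there the adjacent lifts lie over the same vertex and must be equal: homotopic paths
  have lifts with the same final vertex.

  A lift \<open>ft\<close> of \<open>f\<close> transports loops of \<open>Y\<close> to loops of \<open>Xt\<close>, which gives the inclusion of the
  images of the fundamental groups.  Conversely, the inclusion says that for each loop
  \<open>\<gamma>\<close> of \<open>Y\<close> at \<open>y0\<close> the path \<open>f \<circ> \<gamma>\<close> is homotopic to the
  projection of a loop at \<open>xt0\<close>, and therefore lifts to a loop at \<open>xt0\<close> itself.  The lift
  sends \<open>y\<close> to the final vertex of the lift of \<open>f \<circ> \<alpha>\<close>, where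
  \<open>\<alpha>\<close> is a path from \<open>y0\<close> to \<open>y\<close>.  If \<open>\<alpha>\<close> and
  \<open>\<beta>\<close> lead to adjacent vertices \<open>y\<close> and \<open>y'\<close>, then
  \<open>\<alpha>\<close> followed by the reverse of \<open>\<beta>\<close> is a loop at \<open>y0\<close>, and its
  lift, which is again a loop, steps from the final vertex over \<open>y\<close> to the one over \<open>y'\<close>
  (\<open>lift_ends_adjacent\<close>).  As every vertex is adjacent to itself, this one fact shows both that
  the final vertex does not depend on the path and that the map preserves edges.
\<close>

section \<open>Walks and grids\<close>

lemma refl_graph_symD: "refl_graph X \<Longrightarrow> (u, v) \<in> edges X \<Longrightarrow> (v, u) \<in> edges X"
  by (auto simp: refl_graph_def sym_def)

lemma refl_graph_loop: "refl_graph X \<Longrightarrow> v \<in> verts X \<Longrightarrow> (v, v) \<in> edges X"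
  by (auto simp: refl_graph_def refl_on_def)

lemma refl_graph_vertsD: "refl_graph X \<Longrightarrow> (u, v) \<in> edges X \<Longrightarrow> u \<in> verts X \<and> v \<in> verts X"
  by (auto simp: refl_graph_def)

lemma graph_hom_edge: "graph_hom X Y f \<Longrightarrow> (u, v) \<in> edges X \<Longrightarrow> (f u, f v) \<in> edges Y"
  by (auto simp: graph_hom_def)

lemma graph_hom_vert: "graph_hom X Y f \<Longrightarrow> u \<in> verts X \<Longrightarrow> f u \<in> verts Y"
  by (auto simp: graph_hom_def)

lemma graph_hom_comp: "graph_hom X Y f \<Longrightarrow> graph_hom Y Z g \<Longrightarrow> graph_hom X Z (g \<circ> f)"
  by (fastforce simp: graph_hom_def)

lemma walk_iff:
  assumes "refl_graph X"
  shows "graph_hom I_inf X g \<longleftrightarrow> (\<forall>m. (g m, g (m + 1)) \<in> edges X)"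
proof
  assume "graph_hom I_inf X g"
  then show "\<forall>m. (g m, g (m + 1)) \<in> edges X"
    using graph_hom_edge[of I_inf X g] by (simp add: I_inf_def)
next
  assume step: "\<forall>m. (g m, g (m + 1)) \<in> edges X"
  have "(g i, g j) \<in> edges X" if "\<bar>i - j\<bar> \<le> 1" for i j
  proof -
    consider "j = i" | "j = i + 1" | "i = j + 1" using \<open>\<bar>i - j\<bar> \<le> 1\<close> by linarith
    then show ?thesis
    proof cases
      case 1
      then show ?thesis using step refl_graph_loop[OF assms] refl_graph_vertsD[OF assms] by blast
    next
      case 2
      then show ?thesis using step by simp
    next
      case 3
      then show ?thesis using step refl_graph_symD[OF assms] by simp
    qed
  qed
  moreover have "g m \<in> verts X" for m
    using step refl_graph_vertsD[OF assms] by blast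
  ultimately show "graph_hom I_inf X g"
    by (auto simp: graph_hom_def I_inf_def)
qed

lemma grid_iff:
  "graph_hom I_inf2 X H \<longleftrightarrow>
    (\<forall>b. graph_hom I_inf X (\<lambda>a. H (a, b))) \<and> (\<forall>a. graph_hom I_inf X (\<lambda>b. H (a, b)))"
  by (fastforce simp: graph_hom_def I_inf_def I_inf2_def)

section \<open>Ends of stable paths\<close>

text \<open>Only the eventual values of a stable path matter for the argument, and not the indices at
  which they are attained first.  Stability is therefore restated with the filters
  \<^const>\<open>at_bot\<close> and \<^const>\<open>at_top\<close>.\<close>

lemma int_GreatestI:
  fixes q b :: int
  assumes "P q" and bound: "\<And>m. P m \<Longrightarrow> m \<le> b"
  shows "P (Greatest P)"
proof -
  let ?S = "{m \<in> {q..b}. P m}"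
  have fin: "finite ?S" by (rule finite_subset[of _ "{q..b}"]) auto
  have ne: "q \<in> ?S" using assms by auto
  then have M: "Max ?S \<in> ?S" using Max_in[OF fin] by blast
  have "m \<le> Max ?S" if "P m" for m
  proof (cases "m \<ge> q")
    case True
    then show ?thesis using Max_ge[OF fin] bound that by simp
  next
    case False
    then show ?thesis using M by simp
  qed
  then have "Greatest P = Max ?S" using M by (intro Greatest_equality) auto
  then show ?thesis using M by simp
qed

lemma int_LeastI:
  fixes q b :: int
  assumes "P q" and bound: "\<And>m. P m \<Longrightarrow> b \<le> m"
  shows "P (Least P)"
proof -
  let ?S = "{m \<in> {b..q}. P m}"
  have fin: "finite ?S" by (rule finite_subset[of _ "{b..q}"]) auto
  have ne: "q \<in> ?S" using assms by auto
  then have M: "Min ?S \<in> ?S" using Min_in[OF fin] by blast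
  have "Min ?S \<le> m" if "P m" for m
  proof (cases "m \<le> q")
    case True
    then show ?thesis using Min_le[OF fin] bound that by simp
  next
    case False
    then show ?thesis using M by simp
  qed
  then have "Least P = Min ?S" using M by (intro Least_equality) auto
  then show ?thesis using M by simp
qed

lemma neg_idx_eventual:
  assumes "\<forall>\<^sub>F m in at_bot. F m = c" and "m \<le> neg_idx F"
  shows "F m = c"
proof -
  obtain q where q: "\<And>m. m \<le> q \<Longrightarrow> F m = c"
    using assms(1) by (auto simp: eventually_at_bot_linorder)
  show ?thesis
  proof (cases "\<forall>m m'. F m = F m'")
    case True
    then have "F m = F q" by blast
    then show ?thesis using q by simp
  next
    case False
    then obtain i j where ij: "F i \<noteq> F j" by blast
    let ?P = "\<lambda>q. \<forall>m\<le>q. F m = F q"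
    have idx: "neg_idx F = Greatest ?P" using False by (auto simp: neg_idx_def)
    have bound: "k \<le> max i j" if "?P k" for k
      using that ij by (metis linear max.bounded_iff max.cobounded1 max.cobounded2)
    have "?P q" using q by simp
    then have "?P (neg_idx F)" unfolding idx using bound by (rule int_GreatestI)
    then have "F m = F (min q (neg_idx F))" using assms(2) by (metis min.cobounded2)
    then show ?thesis using q by simp
  qed
qed

lemma pos_idx_eventual:
  assumes "\<forall>\<^sub>F m in at_top. F m = c" and "pos_idx F \<le> m"
  shows "F m = c"
proof -
  obtain q where q: "\<And>m. q \<le> m \<Longrightarrow> F m = c"
    using assms(1) by (auto simp: eventually_at_top_linorder)
  show ?thesis
  proof (cases "\<forall>m m'. F m = F m'")
    case True
    then have "F m = F q" by blast
    then show ?thesis using q by simp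
  next
    case False
    then obtain i j where ij: "F i \<noteq> F j" by blast
    let ?P = "\<lambda>q. \<forall>m\<ge>q. F m = F q"
    have idx: "pos_idx F = Least ?P" using False by (auto simp: pos_idx_def)
    have bound: "min i j \<le> k" if "?P k" for k
      using that ij by (metis linear min.bounded_iff min.cobounded1 min.cobounded2)
    have "?P q" using q by simp
    then have "?P (pos_idx F)" unfolding idx using bound by (rule int_LeastI)
    then have "F m = F (max q (pos_idx F))" using assms(2) by (metis max.cobounded2)
    then show ?thesis using q by simp
  qed
qed

lemma stab_neg_iff: "stab_neg F \<longleftrightarrow> (\<forall>\<^sub>F m in at_bot. F m = F (neg_idx F))"
proof
  assume "stab_neg F"
  then obtain c where c: "\<forall>\<^sub>F m in at_bot. F m = c"
    by (auto simp: stab_neg_def eventually_at_bot_linorder)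
  with neg_idx_eventual[OF c order_refl] show "\<forall>\<^sub>F m in at_bot. F m = F (neg_idx F)" by simp
next
  assume "\<forall>\<^sub>F m in at_bot. F m = F (neg_idx F)"
  then show "stab_neg F"
    unfolding stab_neg_def eventually_at_bot_linorder by (metis order_refl)
qed

lemma stab_pos_iff: "stab_pos F \<longleftrightarrow> (\<forall>\<^sub>F m in at_top. F m = F (pos_idx F))"
proof
  assume "stab_pos F"
  then obtain c where c: "\<forall>\<^sub>F m in at_top. F m = c"
    by (auto simp: stab_pos_def eventually_at_top_linorder)
  with pos_idx_eventual[OF c order_refl] show "\<forall>\<^sub>F m in at_top. F m = F (pos_idx F)" by simp
next
  assume "\<forall>\<^sub>F m in at_top. F m = F (pos_idx F)"
  then show "stab_pos F"
    unfolding stab_pos_def eventually_at_top_linorder by (metis order_refl)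
qed

lemma neg_end_iff:
  "stab_neg F \<and> F (neg_idx F) = c \<longleftrightarrow> (\<forall>\<^sub>F m in at_bot. F m = c)"
proof
  assume "stab_neg F \<and> F (neg_idx F) = c"
  then show "\<forall>\<^sub>F m in at_bot. F m = c" using stab_neg_iff by metis
next
  assume c: "\<forall>\<^sub>F m in at_bot. F m = c"
  then have "F (neg_idx F) = c" by (rule neg_idx_eventual) simp
  then show "stab_neg F \<and> F (neg_idx F) = c" using c stab_neg_iff[of F] by simp
qed

lemma pos_end_iff:
  "stab_pos F \<and> F (pos_idx F) = c \<longleftrightarrow> (\<forall>\<^sub>F m in at_top. F m = c)"
proof
  assume "stab_pos F \<and> F (pos_idx F) = c"
  then show "\<forall>\<^sub>F m in at_top. F m = c" using stab_pos_iff by metis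
next
  assume c: "\<forall>\<^sub>F m in at_top. F m = c"
  then have "F (pos_idx F) = c" by (rule pos_idx_eventual) simp
  then show "stab_pos F \<and> F (pos_idx F) = c" using c stab_pos_iff[of F] by simp
qed

definition path_between :: "'a graph \<Rightarrow> 'a \<Rightarrow> 'a \<Rightarrow> (int \<Rightarrow> 'a) \<Rightarrow> bool" where
  "path_between X v w g \<longleftrightarrow> graph_hom I_inf X g \<and>
     (\<forall>\<^sub>F m in at_bot. g m = v) \<and> (\<forall>\<^sub>F m in at_top. g m = w)"

lemma path_between_iff:
  "path_between X v w g \<longleftrightarrow> g \<in> S1 X \<and> g (neg_idx g) = v \<and> g (pos_idx g) = w"
  using neg_end_iff[of g v] pos_end_iff[of g w] unfolding path_between_def S1_def mem_Collect_eq
  by argo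

lemma B1_iff: "g \<in> B1 X v \<longleftrightarrow> path_between X v v g"
  by (auto simp: B1_def path_between_iff)

lemma path_between_hom: "path_between X v w g \<Longrightarrow> graph_hom I_inf X g"
  by (simp add: path_between_def)

lemma path_between_vert: "path_between X v w g \<Longrightarrow> g m \<in> verts X"
  using graph_hom_vert[of I_inf X g m] by (simp add: path_between_def I_inf_def)

lemma path_between_unique_end:
  assumes "path_between X v w g" and "path_between X' v' w' g"
  shows "v = v'" and "w = w'"
  using assms unfolding path_between_iff by blast+

lemma path_between_comp:
  assumes "path_between X v w g" and "graph_hom X Z h"
  shows "path_between Z (h v) (h w) (h \<circ> g)"
  using assms graph_hom_comp[of I_inf X g Z h] unfolding path_between_def
  by (auto elim: eventually_mono)

lemma path_between_const:
  assumes "refl_graph X" and "v \<in> verts X"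
  shows "path_between X v v (\<lambda>_. v)"
  using assms by (simp add: path_between_def walk_iff refl_graph_loop)

section \<open>Path homotopies\<close>

definition homotopy_between ::
  "'a graph \<Rightarrow> 'a \<Rightarrow> 'a \<Rightarrow> (int \<Rightarrow> 'a) \<Rightarrow> (int \<Rightarrow> 'a) \<Rightarrow> (int \<times> int \<Rightarrow> 'a) \<Rightarrow> bool" where
  "homotopy_between X v w f g H \<longleftrightarrow> graph_hom I_inf2 X H \<and>
     (\<forall>\<^sub>F a in at_bot. \<forall>b. H (a, b) = v) \<and> (\<forall>\<^sub>F a in at_top. \<forall>b. H (a, b) = w) \<and>
     (\<forall>\<^sub>F b in at_bot. \<forall>a. H (a, b) = f a) \<and> (\<forall>\<^sub>F b in at_top. \<forall>a. H (a, b) = g a)"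

lemma path_homotopic_iff:
  "(f, g) \<in> path_homotopic X \<longleftrightarrow>
    (\<exists>v w H. path_between X v w f \<and> path_between X v w g \<and> homotopy_between X v w f g H)"
proof -
  have ends: "(\<forall>\<^sub>F a in at_bot. \<forall>b. H (a, b) = v) \<longleftrightarrow>
        stab_neg (dir1 H) \<and> (\<forall>b. H (neg_idx (dir1 H), b) = v)"
      "(\<forall>\<^sub>F a in at_top. \<forall>b. H (a, b) = w) \<longleftrightarrow>
        stab_pos (dir1 H) \<and> (\<forall>b. H (pos_idx (dir1 H), b) = w)"
      "(\<forall>\<^sub>F b in at_bot. \<forall>a. H (a, b) = f a) \<longleftrightarrow>
        stab_neg (dir2 H) \<and> (\<forall>a. H (a, neg_idx (dir2 H)) = f a)"
      "(\<forall>\<^sub>F b in at_top. \<forall>a. H (a, b) = g a) \<longleftrightarrow>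
        stab_pos (dir2 H) \<and> (\<forall>a. H (a, pos_idx (dir2 H)) = g a)" for H v w
    using neg_end_iff[of "dir1 H" "\<lambda>_. v"] pos_end_iff[of "dir1 H" "\<lambda>_. w"]
      neg_end_iff[of "dir2 H" f] pos_end_iff[of "dir2 H" g]
    by (simp_all add: dir1_def dir2_def fun_eq_iff)
  show ?thesis
    unfolding path_homotopic_def is_path_homotopy_def homotopy_between_def ends path_between_iff
      S2_def
    by auto
qed

lemma path_homotopic_refl:
  assumes "refl_graph X" and "path_between X v w f"
  shows "(f, f) \<in> path_homotopic X"
proof -
  have "homotopy_between X v w f f (f \<circ> fst)"
    using assms path_between_vert[OF assms(2)]
    unfolding homotopy_between_def path_between_def
    by (simp add: grid_iff comp_def refl_graph_loop[OF assms(1)] walk_iff)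
  then show ?thesis using assms(2) unfolding path_homotopic_iff by blast
qed

text \<open>Two homotopies are stacked: the first is cut off where its rows have become the middle path,
  and continued with the second from the point where its rows cease to be that path.\<close>

lemma path_homotopic_trans:
  assumes X: "refl_graph X" and "(f, g) \<in> path_homotopic X" and "(g, h) \<in> path_homotopic X"
  shows "(f, h) \<in> path_homotopic X"
proof -
  obtain v w H where H: "path_between X v w f" "path_between X v w g" "homotopy_between X v w f g H"
    using assms(2) unfolding path_homotopic_iff by blast
  obtain v' w' K where K': "path_between X v' w' g" "path_between X v' w' h"
      "homotopy_between X v' w' g h K"
    using assms(3) unfolding path_homotopic_iff by blast
  then have K: "path_between X v w h" "homotopy_between X v w g h K"
    using path_between_unique_end[OF H(2) K'(1)] by auto
  obtain p where p: "\<And>a b. b \<ge> p \<Longrightarrow> H (a, b) = g a"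
    using H(3) unfolding homotopy_between_def eventually_at_top_linorder by blast
  obtain q where q: "\<And>a b. b \<le> q \<Longrightarrow> K (a, b) = g a"
    using K(2) unfolding homotopy_between_def eventually_at_bot_linorder by blast
  define L where "L = (\<lambda>(a, b). if b \<le> 0 then H (a, b + p) else K (a, b + q))"
  have hom: "graph_hom I_inf2 X H" "graph_hom I_inf2 X K"
    using H(3) K(2) by (simp_all add: homotopy_between_def)
  have "(L (a, b), L (a + 1, b)) \<in> edges X" for a b
    using hom by (simp add: L_def grid_iff walk_iff[OF X])
  moreover have "(L (a, b), L (a, b + 1)) \<in> edges X" for a b
  proof -
    have HH: "(H (a, b + p), H (a, b + p + 1)) \<in> edges X"
      and KK: "(K (a, b + q), K (a, b + q + 1)) \<in> edges X"
      using hom by (simp_all add: grid_iff walk_iff[OF X])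
    consider "b < 0" | "b = 0" | "b > 0" by linarith
    then show ?thesis
    proof cases
      case 2
      \<comment> \<open>The seam: both homotopies show the middle path in this row.\<close>
      then have "L (a, b) = K (a, b + q)" using p[of p a] q[of q a] by (simp add: L_def)
      then show ?thesis using KK 2 by (simp add: L_def add.commute)
    qed (use HH KK in \<open>simp_all add: L_def algebra_simps\<close>)
  qed
  ultimately have "graph_hom I_inf2 X L" by (simp add: grid_iff walk_iff[OF X])
  moreover have "\<forall>\<^sub>F a in at_bot. \<forall>b. L (a, b) = v" "\<forall>\<^sub>F a in at_top. \<forall>b. L (a, b) = w"
  proof -
    have "\<forall>\<^sub>F a in at_bot. \<forall>b. H (a, b) = v" "\<forall>\<^sub>F a in at_bot. \<forall>b. K (a, b) = v"
      using H(3) K(2) by (simp_all add: homotopy_between_def)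
    then show "\<forall>\<^sub>F a in at_bot. \<forall>b. L (a, b) = v"
      by eventually_elim (simp add: L_def)
    have "\<forall>\<^sub>F a in at_top. \<forall>b. H (a, b) = w" "\<forall>\<^sub>F a in at_top. \<forall>b. K (a, b) = w"
      using H(3) K(2) by (simp_all add: homotopy_between_def)
    then show "\<forall>\<^sub>F a in at_top. \<forall>b. L (a, b) = w"
      by eventually_elim (simp add: L_def)
  qed
  moreover have "\<forall>\<^sub>F b in at_bot. \<forall>a. L (a, b) = f a"
  proof -
    obtain r where "\<And>a b. b \<le> r \<Longrightarrow> H (a, b) = f a"
      using H(3) unfolding homotopy_between_def eventually_at_bot_linorder by blast
    then have "L (a, b) = f a" if "b \<le> min 0 (r - p)" for a b
      using that by (simp add: L_def)
    then show ?thesis unfolding eventually_at_bot_linorder by blast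
  qed
  moreover have "\<forall>\<^sub>F b in at_top. \<forall>a. L (a, b) = h a"
  proof -
    obtain r where "\<And>a b. b \<ge> r \<Longrightarrow> K (a, b) = h a"
      using K(2) unfolding homotopy_between_def eventually_at_top_linorder by blast
    then have "L (a, b) = h a" if "b \<ge> max 1 (r - q)" for a b
      using that by (simp add: L_def)
    then show ?thesis unfolding eventually_at_top_linorder by blast
  qed
  ultimately have "homotopy_between X v w f h L" by (simp add: homotopy_between_def)
  then show ?thesis using H(1) K(1) unfolding path_homotopic_iff by blast
qed

lemma path_homotopic_comp:
  assumes "(g, h) \<in> path_homotopic X" and "graph_hom X Z k"
  shows "(k \<circ> g, k \<circ> h) \<in> path_homotopic Z"
proof -
  obtain v w H where H: "path_between X v w g" "path_between X v w h" "homotopy_between X v w g h H"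
    using assms(1) unfolding path_homotopic_iff by blast
  have "homotopy_between Z (k v) (k w) (k \<circ> g) (k \<circ> h) (k \<circ> H)"
    using H(3) assms(2) graph_hom_comp[of I_inf2 X H Z k] unfolding homotopy_between_def
    by (auto elim: eventually_mono)
  then show ?thesis
    using path_between_comp[OF H(1) assms(2)] path_between_comp[OF H(2) assms(2)]
    unfolding path_homotopic_iff by blast
qed

lemma induced_map_class:
  assumes "refl_graph X" and "refl_graph Z" and "graph_hom X Z k" and "path_between X v w g"
  shows "induced_map Z k (path_homotopic X `` {g}) = path_homotopic Z `` {k \<circ> g}"
  unfolding induced_map_def
  using path_homotopic_refl[OF assms(1,4)] path_homotopic_comp[OF _ assms(3)]
    path_homotopic_trans[OF assms(2)]
  by blast

section \<open>Lifting paths and homotopies\<close>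

lemma has_cycle_3I:
  assumes "refl_graph X" and edge: "(a, b) \<in> edges X" "(b, c) \<in> edges X" "(c, a) \<in> edges X"
    and "distinct [a, b, c]"
  shows "has_cycle 3 X"
proof -
  have "([a, b, c] ! i, [a, b, c] ! (Suc i mod 3)) \<in> edges X" if "i < 3" for i
  proof -
    consider "i = 0" | "i = 1" | "i = 2" using \<open>i < 3\<close> by linarith
    then show ?thesis using edge by cases simp_all
  qed
  moreover have "set [a, b, c] \<subseteq> verts X"
    using edge[THEN refl_graph_vertsD[OF assms(1)]] by simp
  moreover have "length [a, b, c] = 3" by simp
  ultimately show ?thesis using assms(5) unfolding has_cycle_def by blast
qed

lemma has_cycle_4I:
  assumes "refl_graph X"
    and edge: "(a, b) \<in> edges X" "(b, c) \<in> edges X" "(c, d) \<in> edges X" "(d, a) \<in> edges X"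
    and "distinct [a, b, c, d]"
  shows "has_cycle 4 X"
proof -
  have "([a, b, c, d] ! i, [a, b, c, d] ! (Suc i mod 4)) \<in> edges X" if "i < 4" for i
  proof -
    consider "i = 0" | "i = 1" | "i = 2" | "i = 3" using \<open>i < 4\<close> by linarith
    then show ?thesis using edge by cases simp_all
  qed
  moreover have "set [a, b, c, d] \<subseteq> verts X"
    using edge[THEN refl_graph_vertsD[OF assms(1)]] by simp
  moreover have "length [a, b, c, d] = 4" by simp
  ultimately show ?thesis using assms(6) unfolding has_cycle_def by blast
qed

context
  fixes Xt :: "'a graph" and X :: "'b graph" and \<rho> :: "'a \<Rightarrow> 'b"
  assumes refl_Xt: "refl_graph Xt" and refl_X: "refl_graph X"
    and local_iso: "local_isomorphism Xt X \<rho>"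
begin

lemma local_iso_hom: "graph_hom Xt X \<rho>"
  using local_iso by (simp add: local_isomorphism_def)

lemma bij_nbhd:
  assumes "w \<in> verts Xt"
  shows "bij_betw \<rho> (nbhd Xt w) (nbhd X (\<rho> w))"
  using assms local_iso graph_hom_vert[OF local_iso_hom] by (simp add: local_isomorphism_def)

lemma edge_lift:
  assumes "w \<in> verts Xt" and "(\<rho> w, v) \<in> edges X"
  obtains u where "(w, u) \<in> edges Xt" and "\<rho> u = v"
proof -
  have "v \<in> nbhd X (\<rho> w)"
    using assms(2) refl_graph_symD[OF refl_X] refl_graph_vertsD[OF refl_X]
    by (auto simp: nbhd_def)
  then have "v \<in> \<rho> ` nbhd Xt w"
    using bij_betw_imp_surj_on[OF bij_nbhd[OF assms(1)]] by simp
  then obtain u where "u \<in> nbhd Xt w" "\<rho> u = v" by blast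
  then show thesis using that[of u] refl_graph_symD[OF refl_Xt, of u w] by (simp add: nbhd_def)
qed

lemma neighbours_eq:
  assumes "(w, u) \<in> edges Xt" and "(w, u') \<in> edges Xt" and "\<rho> u = \<rho> u'"
  shows "u = u'"
proof -
  have w: "w \<in> verts Xt" and "u \<in> nbhd Xt w" "u' \<in> nbhd Xt w"
    using assms refl_graph_symD[OF refl_Xt] refl_graph_vertsD[OF refl_Xt]
    by (auto simp: nbhd_def)
  then show ?thesis
    using bij_nbhd[OF w] assms(3) by (auto simp: bij_betw_def dest: inj_onD)
qed

lemma adjacent_eq:
  assumes "(w, u) \<in> edges Xt" and "\<rho> w = \<rho> u"
  shows "w = u"
  using neighbours_eq[of w w u] assms refl_graph_loop[OF refl_Xt] refl_graph_vertsD[OF refl_Xt]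
  by blast

text \<open>The images of the four vertices form a closed walk of length four.  It is not a 4-cycle, so
  two of its vertices coincide.  If these are opposite, the local injectivity of \<open>\<rho>\<close> identifies
  their lifts.  If they are consecutive, the remaining three are not a 3-cycle, and the walk
  collapses further to an edge.\<close>

lemma square_lift:
  assumes no3: "\<not> has_cycle 3 X" and no4: "\<not> has_cycle 4 X"
    and bottom: "(s, t) \<in> edges Xt" and top: "(s', t') \<in> edges Xt" and left: "(s, s') \<in> edges Xt"
    and right: "(\<rho> t, \<rho> t') \<in> edges X"
  shows "(t, t') \<in> edges Xt"
proof -
  note sym = refl_graph_symD[OF refl_Xt]
  have loop: "(t, t) \<in> edges Xt" "(t', t') \<in> edges Xt"
    using refl_graph_vertsD[OF refl_Xt bottom] refl_graph_vertsD[OF refl_Xt top]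
    by (simp_all add: refl_graph_loop[OF refl_Xt])
  have walk: "(\<rho> s, \<rho> t) \<in> edges X" "(\<rho> t', \<rho> s') \<in> edges X" "(\<rho> s', \<rho> s) \<in> edges X"
    using graph_hom_edge[OF local_iso_hom bottom] graph_hom_edge[OF local_iso_hom sym[OF top]]
      graph_hom_edge[OF local_iso_hom sym[OF left]] by simp_all
  have triangle: "a = b \<or> b = c \<or> c = a"
    if "(a, b) \<in> edges X" "(b, c) \<in> edges X" "(c, a) \<in> edges X" for a b c
    using has_cycle_3I[OF refl_X that] no3 by auto
  consider (diag1) "\<rho> s = \<rho> t'" | (diag2) "\<rho> t = \<rho> s'"
    | (nodiag) "\<rho> s \<noteq> \<rho> t'" "\<rho> t \<noteq> \<rho> s'" by blast
  then show ?thesis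
  proof cases
    case diag1
    then have "s = t'" using neighbours_eq[OF sym[OF left] top] by blast
    then show ?thesis using sym[OF bottom] by simp
  next
    case diag2
    then have "t = s'" using neighbours_eq[OF bottom left] by blast
    then show ?thesis using top by simp
  next
    case nodiag
    consider "\<rho> s = \<rho> s'" | "\<rho> s = \<rho> t" | "\<rho> s' = \<rho> t'" | "\<rho> t = \<rho> t'"
      | (distinct) "\<rho> s \<noteq> \<rho> s'" "\<rho> s \<noteq> \<rho> t" "\<rho> s' \<noteq> \<rho> t'" "\<rho> t \<noteq> \<rho> t'" by blast
    then show ?thesis
    proof cases
      case 1
      then have "s = s'" using adjacent_eq[OF left] by blast
      moreover have "\<rho> t = \<rho> t'"
        using triangle[of "\<rho> s" "\<rho> t" "\<rho> t'"] walk right 1 nodiag by metis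
      ultimately have "t = t'" using neighbours_eq[of s t t'] bottom top by simp
      then show ?thesis using loop by simp
    next
      case 2
      then have "s = t" using adjacent_eq[OF bottom] by blast
      moreover have "\<rho> s' = \<rho> t'"
        using triangle[of "\<rho> t" "\<rho> t'" "\<rho> s'"] walk right 2 nodiag by metis
      ultimately show ?thesis using adjacent_eq[OF top] left by simp
    next
      case 3
      then have "s' = t'" using adjacent_eq[OF top] by blast
      moreover have "\<rho> s = \<rho> t"
        using triangle[of "\<rho> s" "\<rho> t" "\<rho> t'"] walk right 3 nodiag by metis
      ultimately show ?thesis using adjacent_eq[OF bottom] left by simp
    next
      case 4
      then consider "\<rho> s = \<rho> t" | "\<rho> s = \<rho> s'"
        using triangle[of "\<rho> s" "\<rho> t" "\<rho> s'"] walk nodiag by metis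
      then show ?thesis
      proof cases
        case 1
        then show ?thesis using 4 nodiag by simp
      next
        case 2
        then have "s = s'" using adjacent_eq[OF left] by blast
        then have "t = t'" using neighbours_eq[of s t t'] bottom top 4 by simp
        then show ?thesis using loop by simp
      qed
    next
      case distinct
      then have "has_cycle 4 X"
        using has_cycle_4I[OF refl_X walk(1) right walk(2,3)] nodiag by auto
      then show ?thesis using no4 by contradiction
    qed
  qed
qed

lemma walk_lift_unique:
  assumes g: "graph_hom I_inf Xt g" and h: "graph_hom I_inf Xt h"
    and "\<rho> \<circ> g = \<rho> \<circ> h" and "g q = h q"
  shows "g = h"
proof
  fix m
  have edge: "(g m, g (m + 1)) \<in> edges Xt" "(h m, h (m + 1)) \<in> edges Xt"
      "(g m, g (m - 1)) \<in> edges Xt" "(h m, h (m - 1)) \<in> edges Xt" for m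
    using g h graph_hom_edge[of I_inf Xt _ m "m + 1"] graph_hom_edge[of I_inf Xt _ m "m - 1"]
    by (simp_all add: I_inf_def)
  have fib: "\<rho> (g m) = \<rho> (h m)" for m using assms(3) by (metis comp_apply)
  show "g m = h m"
  proof (induction m rule: int_induct[where k = q])
    case base
    then show ?case by (rule assms(4))
  next
    case (step1 i)
    then show ?case using edge(1)[of i] edge(2)[of i] fib[of "i + 1"] neighbours_eq by metis
  next
    case (step2 i)
    then show ?case using edge(3)[of i] edge(4)[of i] fib[of "i - 1"] neighbours_eq by metis
  qed
qed

lemma path_lift_unique:
  assumes "path_between Xt v w g" and "path_between Xt v w' h" and "\<rho> \<circ> g = \<rho> \<circ> h"
  shows "g = h"
proof -
  have "\<forall>\<^sub>F m in at_bot. g m = v" "\<forall>\<^sub>F m in at_bot. h m = v"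
    using assms by (simp_all add: path_between_def)
  then have "\<forall>\<^sub>F m in at_bot. g m = h m" by eventually_elim simp
  then obtain q where "g q = h q" unfolding eventually_at_bot_linorder by blast
  then show ?thesis
    by (rule walk_lift_unique[OF path_between_hom[OF assms(1)] path_between_hom[OF assms(2)] assms(3)])
qed

lemma path_lift:
  assumes g: "path_between X v w g" and vt: "vt \<in> verts Xt" "\<rho> vt = v"
  obtains gt wt where "path_between Xt vt wt gt" and "\<rho> \<circ> gt = g"
proof -
  obtain q where q: "\<And>m. m \<le> q \<Longrightarrow> g m = v"
    using g unfolding path_between_def eventually_at_bot_linorder by blast
  obtain p where p: "\<And>m. m \<ge> p \<Longrightarrow> g m = w"
    using g unfolding path_between_def eventually_at_top_linorder by blast
  have edge: "(g m, g (m + 1)) \<in> edges X" for m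
    using path_between_hom[OF g] walk_iff[OF refl_X] by blast
  let ?P = "\<lambda>n u. u \<in> verts Xt \<and> \<rho> u = g (q + int n) \<and> (n = 0 \<longrightarrow> u = vt)"
  have "\<exists>h. \<forall>n. ?P n (h n) \<and> (h n, h (Suc n)) \<in> edges Xt"
  proof (rule dependent_nat_choice[where P = ?P and Q = "\<lambda>n u u'. (u, u') \<in> edges Xt"])
    show "\<exists>u. ?P 0 u" using vt q by simp
  next
    fix u n
    assume u: "?P n u"
    then have "(\<rho> u, g (q + int (Suc n))) \<in> edges X"
      using edge[of "q + int n"] by (simp add: algebra_simps)
    then obtain u' where u': "(u, u') \<in> edges Xt" "\<rho> u' = g (q + int (Suc n))"
      using edge_lift u by blast
    then show "\<exists>u'. ?P (Suc n) u' \<and> (u, u') \<in> edges Xt"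
      using refl_graph_vertsD[OF refl_Xt u'(1)] by auto
  qed
  then obtain h where h: "\<And>n. h n \<in> verts Xt" "\<And>n. \<rho> (h n) = g (q + int n)" "h 0 = vt"
      "\<And>n. (h n, h (Suc n)) \<in> edges Xt"
    by blast
  define gt where "gt = (\<lambda>m. h (nat (m - q)))"
  have gt_edge: "(gt m, gt (m + 1)) \<in> edges Xt" for m
  proof (cases "m \<ge> q")
    case True
    then have "nat (m + 1 - q) = Suc (nat (m - q))" by simp
    then show ?thesis using h(4) by (simp add: gt_def)
  next
    case False
    then show ?thesis using refl_graph_loop[OF refl_Xt] h(1) by (simp add: gt_def)
  qed
  have fib: "\<rho> (gt m) = g m" for m
    using q h(2)[of "nat (m - q)"] h(2)[of 0] by (cases "m \<ge> q") (simp_all add: gt_def)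
  have "gt m = gt p" if "m \<ge> p" for m
    using that
  proof (induction m rule: int_ge_induct)
    case (step i)
    then have "gt i = gt (i + 1)" using adjacent_eq[OF gt_edge[of i]] fib p by simp
    then show ?case using step by simp
  qed simp
  then have "\<forall>\<^sub>F m in at_top. gt m = gt p" unfolding eventually_at_top_linorder by blast
  moreover have "\<forall>\<^sub>F m in at_bot. gt m = vt"
    unfolding eventually_at_bot_linorder by (rule exI[of _ q]) (simp add: gt_def h(3))
  ultimately have "path_between Xt vt (gt p) gt"
    using gt_edge by (simp add: path_between_def walk_iff[OF refl_Xt])
  then show thesis using that fib by (auto simp: fun_eq_iff)
qed

text \<open>The rows of the homotopy are lifted one by one, from the same vertex.  By induction along the
  columns, \<open>square_lift\<close> keeps the lifts of consecutive rows adjacent.\<close>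

lemma homotopic_lifts_same_end:
  assumes no3: "\<not> has_cycle 3 X" and no4: "\<not> has_cycle 4 X"
    and "(\<rho> \<circ> g, \<rho> \<circ> h) \<in> path_homotopic X"
    and g: "path_between Xt vt w g" and h: "path_between Xt vt w' h"
  shows "w = w'"
proof -
  obtain v z H where vz: "path_between X v z (\<rho> \<circ> g)" and H: "homotopy_between X v z (\<rho> \<circ> g) (\<rho> \<circ> h) H"
    using assms(3) unfolding path_homotopic_iff by blast
  have vt: "vt \<in> verts Xt" "\<rho> vt = v"
  proof -
    show "\<rho> vt = v"
      using path_between_unique_end[OF vz path_between_comp[OF g local_iso_hom]] by simp
    show "vt \<in> verts Xt" using g path_between_vert[OF g] by (auto simp: path_between_iff)
  qed
  have homH: "graph_hom I_inf2 X H" using H by (simp add: homotopy_between_def)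
  obtain q where q: "\<And>a b. a \<le> q \<Longrightarrow> H (a, b) = v"
    using H unfolding homotopy_between_def eventually_at_bot_linorder by blast
  obtain p where p: "\<And>a b. a \<ge> p \<Longrightarrow> H (a, b) = z"
    using H unfolding homotopy_between_def eventually_at_top_linorder by blast
  have row: "path_between X v z (\<lambda>a. H (a, b))" for b
    using H homH unfolding path_between_def homotopy_between_def grid_iff
    by (auto elim: eventually_mono)
  have "\<forall>b. \<exists>k. (\<exists>u. path_between Xt vt u k) \<and> \<rho> \<circ> k = (\<lambda>a. H (a, b))"
    using path_lift[OF row vt] by metis
  then obtain k where k: "\<And>b. \<exists>u. path_between Xt vt u (k b)" "\<And>b. \<rho> \<circ> k b = (\<lambda>a. H (a, b))"
    by metis
  have fib: "\<rho> (k b a) = H (a, b)" for a b using k(2)[of b] by (metis comp_apply)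
  have k_edge: "(k b a, k b (a + 1)) \<in> edges Xt" for a b
    using k(1) path_between_hom walk_iff[OF refl_Xt] by metis
  have "\<exists>u. \<forall>b. \<forall>a\<ge>p. k b a = u"
  proof -
    have adj: "(k b a, k (b + 1) a) \<in> edges Xt" for a b
    proof -
      obtain u u' where "path_between Xt vt u (k b)" "path_between Xt vt u' (k (b + 1))"
        using k(1) by metis
      then have "\<forall>\<^sub>F m in at_bot. k b m = vt" "\<forall>\<^sub>F m in at_bot. k (b + 1) m = vt"
        by (simp_all add: path_between_def)
      then have "\<forall>\<^sub>F m in at_bot. k b m = vt \<and> k (b + 1) m = vt" by eventually_elim simp
      then obtain r where r: "\<And>m. m \<le> r \<Longrightarrow> k b m = vt \<and> k (b + 1) m = vt"
        unfolding eventually_at_bot_linorder by blast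
      show ?thesis
      proof (cases "a \<le> r")
        case True
        then show ?thesis using r vt refl_graph_loop[OF refl_Xt] by simp
      next
        case False
        then have "a \<ge> r" by simp
        then show ?thesis
        proof (induction a rule: int_ge_induct)
          case base
          show ?case using r[of r] vt refl_graph_loop[OF refl_Xt] by simp
        next
          case (step i)
          have "(\<rho> (k b (i + 1)), \<rho> (k (b + 1) (i + 1))) \<in> edges X"
            using homH by (simp add: fib grid_iff walk_iff[OF refl_X])
          then show ?case using square_lift[OF no3 no4 k_edge k_edge step.IH] by blast
        qed
      qed
    qed
    have col: "k b a = k (b + 1) a" if "a \<ge> p" for a b
      by (rule adjacent_eq[OF adj]) (simp add: fib p[OF that])
    have col0: "k b a = k 0 a" if "a \<ge> p" for a b
    proof (induction b rule: int_induct[where k = 0])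
      case (step1 i)
      then show ?case using col[OF that, of i] by simp
    next
      case (step2 i)
      then show ?case using col[OF that, of "i - 1"] by simp
    qed simp
    have "k 0 a = k 0 p" if "a \<ge> p" for a
      using that
    proof (induction a rule: int_ge_induct)
      case (step i)
      then show ?case using adjacent_eq[OF k_edge[of 0 i]] fib p by simp
    qed simp
    then show ?thesis using col0 by metis
  qed
  then obtain u where u: "\<And>b a. a \<ge> p \<Longrightarrow> k b a = u" by blast
  have last: "y = u" if l: "path_between Xt vt y l" and row_l: "\<And>a. H (a, b) = (\<rho> \<circ> l) a" for y l b
  proof -
    obtain u' where u': "path_between Xt vt u' (k b)" using k(1) by blast
    have "\<rho> \<circ> l = \<rho> \<circ> k b" using row_l fib by (simp add: fun_eq_iff)
    then have "path_between Xt vt u' l" using path_lift_unique[OF l u'] u' by simp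
    then have "y = u'" using path_between_unique_end(2)[OF l] by simp
    moreover have "\<forall>\<^sub>F m in at_top. k b m = u" unfolding eventually_at_top_linorder using u by blast
    then have "path_between Xt vt u (k b)" using u' by (simp add: path_between_def)
    then have "u' = u" using path_between_unique_end(2)[OF u'] by simp
    ultimately show ?thesis by simp
  qed
  obtain b where "\<And>a. H (a, b) = (\<rho> \<circ> g) a"
    using H unfolding homotopy_between_def eventually_at_bot_linorder by blast
  then have "w = u" by (rule last[OF g])
  moreover obtain b' where "\<And>a. H (a, b') = (\<rho> \<circ> h) a"
    using H unfolding homotopy_between_def eventually_at_top_linorder by blast
  then have "w' = u" by (rule last[OF h])
  ultimately show ?thesis by simp
qed

section \<open>The lifting criterion\<close>

text \<open>The inclusion of the images provides a loop at \<open>xt0\<close> whose projection is homotopic to \<open>f \<circ> \<gamma>\<close>; by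
  \<open>homotopic_lifts_same_end\<close>, the lift of \<open>f \<circ> \<gamma>\<close> ends where that loop does.\<close>

lemma loop_lifts_to_loop:
  assumes no3: "\<not> has_cycle 3 X" and no4: "\<not> has_cycle 4 X"
    and Y: "refl_graph Y" and f: "graph_hom Y X f" and xt0: "xt0 \<in> verts Xt" "\<rho> xt0 = f y0"
    and incl: "induced_map X f ` carrier (A1 Y y0) \<subseteq> induced_map X \<rho> ` carrier (A1 Xt xt0)"
    and \<gamma>: "path_between Y y0 y0 \<gamma>"
  obtains gt where "path_between Xt xt0 xt0 gt" and "\<rho> \<circ> gt = f \<circ> \<gamma>"
proof -
  have f\<gamma>: "path_between X (f y0) (f y0) (f \<circ> \<gamma>)" using path_between_comp[OF \<gamma> f] .
  have "path_homotopic Y `` {\<gamma>} \<in> carrier (A1 Y y0)"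
    using \<gamma> by (auto simp: A1_def B1_iff intro: quotientI)
  then obtain c where c: "c \<in> carrier (A1 Xt xt0)"
      and eq: "induced_map X f (path_homotopic Y `` {\<gamma>}) = induced_map X \<rho> c"
    using incl by blast
  obtain \<delta> where \<delta>: "path_between Xt xt0 xt0 \<delta>" "c = path_homotopic Xt `` {\<delta>}"
    using c by (auto simp: A1_def B1_iff elim: quotientE)
  have "path_homotopic X `` {f \<circ> \<gamma>} = path_homotopic X `` {\<rho> \<circ> \<delta>}"
    using eq induced_map_class[OF Y refl_X f \<gamma>] induced_map_class[OF refl_Xt refl_X local_iso_hom \<delta>(1)] \<delta>(2)
    by simp
  then have homotopic: "(\<rho> \<circ> \<delta>, f \<circ> \<gamma>) \<in> path_homotopic X"
    using path_homotopic_refl[OF refl_X f\<gamma>] by blast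
  obtain gt w where gt: "path_between Xt xt0 w gt" "\<rho> \<circ> gt = f \<circ> \<gamma>"
    using path_lift[OF f\<gamma> xt0] by blast
  then have "w = xt0"
    using homotopic_lifts_same_end[OF no3 no4 _ \<delta>(1) gt(1)] homotopic by simp
  then show thesis using that gt by blast
qed

text \<open>The loop that follows \<open>\<alpha>\<close>, takes the edge from \<open>y\<close> to \<open>y'\<close>, and returns along \<open>\<beta>\<close> lifts to a
  loop.  Up to a shift, the two halves of the lift are the lifts of \<open>f \<circ> \<alpha>\<close> and, traversed backwards,
  of \<open>f \<circ> \<beta>\<close>.\<close>

lemma lift_ends_adjacent:
  assumes Y: "refl_graph Y" and f: "graph_hom Y X f"
    and loops: "\<And>\<gamma>. path_between Y y0 y0 \<gamma> \<Longrightarrow> \<exists>gt. path_between Xt xt0 xt0 gt \<and> \<rho> \<circ> gt = f \<circ> \<gamma>"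
    and \<alpha>: "path_between Y y0 y \<alpha>" "path_between Xt xt0 e \<alpha>t" "\<rho> \<circ> \<alpha>t = f \<circ> \<alpha>"
    and \<beta>: "path_between Y y0 y' \<beta>" "path_between Xt xt0 e' \<beta>t" "\<rho> \<circ> \<beta>t = f \<circ> \<beta>"
    and yy': "(y, y') \<in> edges Y"
  shows "(e, e') \<in> edges Xt"
proof -
  have late: "\<exists>p. \<forall>m\<ge>p. k m = z \<and> kt m = zt"
    if "path_between Y y0 z k" "path_between Xt xt0 zt kt" for z zt k kt
  proof -
    have "\<forall>\<^sub>F m in at_top. k m = z" "\<forall>\<^sub>F m in at_top. kt m = zt"
      using that by (simp_all add: path_between_def)
    then have "\<forall>\<^sub>F m in at_top. k m = z \<and> kt m = zt" by eventually_elim simp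
    then show ?thesis by (simp add: eventually_at_top_linorder)
  qed
  have early: "\<exists>p. \<forall>m\<le>p. k m = y0 \<and> kt m = xt0"
    if "path_between Y y0 z k" "path_between Xt xt0 zt kt" for z zt k kt
  proof -
    have "\<forall>\<^sub>F m in at_bot. k m = y0" "\<forall>\<^sub>F m in at_bot. kt m = xt0"
      using that by (simp_all add: path_between_def)
    then have "\<forall>\<^sub>F m in at_bot. k m = y0 \<and> kt m = xt0" by eventually_elim simp
    then show ?thesis by (simp add: eventually_at_bot_linorder)
  qed
  obtain p where p: "\<And>m. m \<ge> p \<Longrightarrow> \<alpha> m = y \<and> \<alpha>t m = e" using late[OF \<alpha>(1,2)] by blast
  obtain q where q: "\<And>m. m \<ge> q \<Longrightarrow> \<beta> m = y' \<and> \<beta>t m = e'" using late[OF \<beta>(1,2)] by blast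
  obtain a where a: "\<And>m. m \<le> a \<Longrightarrow> \<alpha> m = y0 \<and> \<alpha>t m = xt0" using early[OF \<alpha>(1,2)] by blast
  obtain b where b: "\<And>m. m \<le> b \<Longrightarrow> \<beta> m = y0 \<and> \<beta>t m = xt0" using early[OF \<beta>(1,2)] by blast
  \<comment> \<open>The index 0 is the end of the first path, the index 1 the beginning of the reversed second.\<close>
  define \<gamma> where "\<gamma> = (\<lambda>i. if i \<le> 0 then \<alpha> (i + p) else \<beta> (q + 1 - i))"
  have edge: "(\<alpha> m, \<alpha> (m + 1)) \<in> edges Y" "(\<beta> (m + 1), \<beta> m) \<in> edges Y" for m
    using path_between_hom[OF \<alpha>(1)] path_between_hom[OF \<beta>(1)] refl_graph_symD[OF Y]
    by (simp_all add: walk_iff[OF Y])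
  have "(\<gamma> i, \<gamma> (i + 1)) \<in> edges Y" for i
  proof -
    consider "i < 0" | "i = 0" | "i > 0" by linarith
    then show ?thesis
    proof cases
      case 1
      then show ?thesis using edge(1)[of "i + p"] by (simp add: \<gamma>_def algebra_simps)
    next
      case 2
      then show ?thesis using p[of p] q[of q] yy' by (simp add: \<gamma>_def)
    next
      case 3
      then show ?thesis using edge(2)[of "q - i"] by (simp add: \<gamma>_def algebra_simps)
    qed
  qed
  moreover have "\<forall>\<^sub>F i in at_bot. \<gamma> i = y0" unfolding eventually_at_bot_linorder
    by (rule exI[of _ "min 0 (a - p)"]) (use a in \<open>simp add: \<gamma>_def\<close>)
  moreover have "\<forall>\<^sub>F i in at_top. \<gamma> i = y0" unfolding eventually_at_top_linorder
    by (rule exI[of _ "max 1 (q + 1 - b)"]) (use b in \<open>simp add: \<gamma>_def\<close>)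
  ultimately have "path_between Y y0 y0 \<gamma>" by (simp add: path_between_def walk_iff[OF Y])
  then obtain gt where gt: "path_between Xt xt0 xt0 gt" "\<rho> \<circ> gt = f \<circ> \<gamma>" using loops by blast
  have fib: "\<rho> (gt i) = f (\<gamma> i)" "\<rho> (\<alpha>t i) = f (\<alpha> i)" "\<rho> (\<beta>t i) = f (\<beta> i)" for i
    using gt(2) \<alpha>(3) \<beta>(3) by (metis comp_apply)+
  have t_edge: "(gt m, gt (m + 1)) \<in> edges Xt" "(\<alpha>t m, \<alpha>t (m + 1)) \<in> edges Xt"
      "(\<beta>t m, \<beta>t (m + 1)) \<in> edges Xt" for m
    using path_between_hom[OF gt(1)] path_between_hom[OF \<alpha>(2)] path_between_hom[OF \<beta>(2)]
    by (simp_all add: walk_iff[OF refl_Xt])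
  obtain l where l: "\<And>m. m \<le> l \<Longrightarrow> gt m = xt0"
    using gt(1) unfolding path_between_def eventually_at_bot_linorder by blast
  obtain r where r: "\<And>m. m \<ge> r \<Longrightarrow> gt m = xt0"
    using gt(1) unfolding path_between_def eventually_at_top_linorder by blast
  have left: "gt i = \<alpha>t (i + p)" if "i \<le> 0" for i
  proof -
    let ?s = "min i (min l (a - p))"
    have "j \<le> 0 \<longrightarrow> gt j = \<alpha>t (j + p)" if "?s \<le> j" for j
      using that
    proof (induction j rule: int_ge_induct)
      case base
      show ?case using l[of ?s] a[of "?s + p"] by simp
    next
      case (step j)
      show ?case
      proof
        assume "j + 1 \<le> 0"
        then have "gt j = \<alpha>t (j + p)" "\<rho> (gt (j + 1)) = \<rho> (\<alpha>t (j + p + 1))"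
          using step.IH by (simp_all add: fib \<gamma>_def algebra_simps)
        then have "gt (j + 1) = \<alpha>t (j + p + 1)"
          using neighbours_eq t_edge(1)[of j] t_edge(2)[of "j + p"] by metis
        then show "gt (j + 1) = \<alpha>t (j + 1 + p)" by (simp add: algebra_simps)
      qed
    qed
    then show ?thesis using that by simp
  qed
  have right: "\<beta>t i = gt (q + 1 - i)" if "i \<le> q" for i
  proof -
    let ?s = "min i (min b (q + 1 - r))"
    have "j \<le> q \<longrightarrow> \<beta>t j = gt (q + 1 - j)" if "?s \<le> j" for j
      using that
    proof (induction j rule: int_ge_induct)
      case base
      show ?case using r[of "q + 1 - ?s"] b[of ?s] by simp
    next
      case (step j)
      show ?case
      proof
        assume j: "j + 1 \<le> q"
        then have IH: "\<beta>t j = gt (q + 1 - j)" using step.IH by simp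
        have "\<rho> (gt (q - j)) = \<rho> (\<beta>t (j + 1))"
          using j by (simp add: fib \<gamma>_def algebra_simps)
        moreover have "(\<beta>t j, gt (q - j)) \<in> edges Xt"
          using t_edge(1)[of "q - j"] refl_graph_symD[OF refl_Xt] IH by (simp add: algebra_simps)
        ultimately have "gt (q - j) = \<beta>t (j + 1)"
          using neighbours_eq t_edge(3)[of j] by metis
        then show "\<beta>t (j + 1) = gt (q + 1 - (j + 1))" by simp
      qed
    qed
    then show ?thesis using that by simp
  qed
  have "gt 0 = e" using left[of 0] p[of p] by simp
  moreover have "gt 1 = e'" using right[of q] q[of q] by simp
  ultimately show ?thesis using t_edge(1)[of 0] by simp
qed

lemma lift_of_loop_condition:
  assumes Y: "refl_graph Y" and f: "graph_hom Y X f" and y0: "y0 \<in> verts Y"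
    and conn: "connected_graph Y" and xt0: "xt0 \<in> verts Xt" "\<rho> xt0 = f y0"
    and loops: "\<And>\<gamma>. path_between Y y0 y0 \<gamma> \<Longrightarrow> \<exists>gt. path_between Xt xt0 xt0 gt \<and> \<rho> \<circ> gt = f \<circ> \<gamma>"
  shows "\<exists>ft. is_lift Y y0 Xt xt0 \<rho> f ft"
proof -
  define R where "R y e \<longleftrightarrow> (\<exists>\<alpha> \<alpha>t. path_between Y y0 y \<alpha> \<and> path_between Xt xt0 e \<alpha>t \<and>
    \<rho> \<circ> \<alpha>t = f \<circ> \<alpha>)" for y e
  have total: "\<exists>e. R y e" if "y \<in> verts Y" for y
  proof -
    have "\<exists>\<alpha>\<in>S1 Y. \<alpha> (neg_idx \<alpha>) = y0 \<and> \<alpha> (pos_idx \<alpha>) = y"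
      using conn y0 that by (simp add: connected_graph_def)
    then obtain \<alpha> where \<alpha>: "path_between Y y0 y \<alpha>" unfolding path_between_iff by blast
    obtain \<alpha>t e where "path_between Xt xt0 e \<alpha>t" "\<rho> \<circ> \<alpha>t = f \<circ> \<alpha>"
      by (rule path_lift[OF path_between_comp[OF \<alpha> f] xt0])
    then show ?thesis using \<alpha> unfolding R_def by blast
  qed
  have adj: "(e, e') \<in> edges Xt"
    if Re: "R y e" and Re': "R y' e'" and yy': "(y, y') \<in> edges Y" for y y' e e'
  proof -
    obtain \<alpha> \<alpha>t where \<alpha>: "path_between Y y0 y \<alpha>" "path_between Xt xt0 e \<alpha>t" "\<rho> \<circ> \<alpha>t = f \<circ> \<alpha>"
      using Re unfolding R_def by blast
    obtain \<beta> \<beta>t where \<beta>: "path_between Y y0 y' \<beta>" "path_between Xt xt0 e' \<beta>t" "\<rho> \<circ> \<beta>t = f \<circ> \<beta>"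
      using Re' unfolding R_def by blast
    show ?thesis by (rule lift_ends_adjacent[OF Y f loops \<alpha> \<beta> yy'])
  qed
  have fib: "\<rho> e = f y" if Rye: "R y e" for y e
  proof -
    obtain \<alpha> \<alpha>t where \<alpha>: "path_between Y y0 y \<alpha>" "path_between Xt xt0 e \<alpha>t" "\<rho> \<circ> \<alpha>t = f \<circ> \<alpha>"
      using Rye unfolding R_def by blast
    have "path_between X (f y0) (f y) (\<rho> \<circ> \<alpha>t)" using path_between_comp[OF \<alpha>(1) f] \<alpha>(3) by simp
    then show ?thesis by (rule path_between_unique_end(2)[OF path_between_comp[OF \<alpha>(2) local_iso_hom]])
  qed
  obtain ft where ft: "\<And>y. y \<in> verts Y \<Longrightarrow> R y (ft y)" using total by metis
  have edge: "(ft y, ft y') \<in> edges Xt" if yy': "(y, y') \<in> edges Y" for y y'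
    using refl_graph_vertsD[OF Y yy'] by (intro adj[OF ft ft yy']) simp_all
  have "\<rho> \<circ> (\<lambda>_. xt0) = f \<circ> (\<lambda>_::int. y0)" using xt0(2) by (simp add: comp_def)
  then have Rbase: "R y0 xt0"
    unfolding R_def using path_between_const[OF Y y0] path_between_const[OF refl_Xt xt0(1)] by blast
  have base: "ft y0 = xt0"
    by (rule adjacent_eq[OF adj[OF ft[OF y0] Rbase refl_graph_loop[OF Y y0]]])
      (simp add: fib[OF ft[OF y0]] xt0(2))
  have "ft y \<in> verts Xt" if "y \<in> verts Y" for y
    using refl_graph_vertsD[OF refl_Xt edge[OF refl_graph_loop[OF Y that]]] by simp
  then have "graph_hom Y Xt ft"
    using edge unfolding graph_hom_def by auto
  moreover have "\<rho> (ft y) = f y" if "y \<in> verts Y" for y using fib[OF ft[OF that]] .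
  ultimately have "is_lift Y y0 Xt xt0 \<rho> f ft"
    using y0 xt0(1) base by (simp add: is_lift_def pointed_hom_def)
  then show ?thesis by blast
qed

lemma lift_imp_incl:
  assumes Y: "refl_graph Y" and f: "graph_hom Y X f" and ft: "is_lift Y y0 Xt xt0 \<rho> f ft"
  shows "induced_map X f ` carrier (A1 Y y0) \<subseteq> induced_map X \<rho> ` carrier (A1 Xt xt0)"
proof
  fix d
  assume "d \<in> induced_map X f ` carrier (A1 Y y0)"
  then obtain \<gamma> where \<gamma>: "path_between Y y0 y0 \<gamma>" and d: "d = induced_map X f (path_homotopic Y `` {\<gamma>})"
    by (auto simp: A1_def B1_iff elim!: quotientE)
  have hom_ft: "graph_hom Y Xt ft" and "ft y0 = xt0"
    using ft by (auto simp: is_lift_def pointed_hom_def)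
  then have ft\<gamma>: "path_between Xt xt0 xt0 (ft \<circ> \<gamma>)" using path_between_comp[OF \<gamma>] by metis
  have "\<rho> \<circ> (ft \<circ> \<gamma>) = f \<circ> \<gamma>"
    using ft path_between_vert[OF \<gamma>] by (auto simp: is_lift_def fun_eq_iff)
  then have "d = induced_map X \<rho> (path_homotopic Xt `` {ft \<circ> \<gamma>})"
    using d induced_map_class[OF Y refl_X f \<gamma>] induced_map_class[OF refl_Xt refl_X local_iso_hom ft\<gamma>] by simp
  moreover have "path_homotopic Xt `` {ft \<circ> \<gamma>} \<in> carrier (A1 Xt xt0)"
    using ft\<gamma> by (auto simp: A1_def B1_iff intro: quotientI)
  ultimately show "d \<in> induced_map X \<rho> ` carrier (A1 Xt xt0)" by blast
qed

end

theorem theorem3p0p13: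
  fixes X :: "'b graph" and Xt :: "'a graph" and Y :: "'c graph"
    and \<rho> :: "'a \<Rightarrow> 'b" and f :: "'c \<Rightarrow> 'b"
    and x0 :: 'b and xt0 :: 'a and y0 :: 'c
  assumes "refl_graph X" and "refl_graph Xt" and "refl_graph Y"
    and "covering_graph Xt \<rho> X"
    and "pointed_hom Y y0 X x0 f"
    and "connected_graph Y"
    and "xt0 \<in> verts Xt" and "\<rho> xt0 = x0"
    and "\<not> has_cycle 3 X" and "\<not> has_cycle 4 X"
  shows "(\<exists>ft. is_lift Y y0 Xt xt0 \<rho> f ft) \<longleftrightarrow>
    induced_map X f ` carrier (A1 Y y0) \<subseteq> induced_map X \<rho> ` carrier (A1 Xt xt0)"
proof -
  have iso: "local_isomorphism Xt X \<rho>" using assms(4) by (simp add: covering_graph_def)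
  have f: "graph_hom Y X f" and y0: "y0 \<in> verts Y" and xt0: "\<rho> xt0 = f y0"
    using assms(5,8) by (auto simp: pointed_hom_def)
  show ?thesis
  proof
    assume "\<exists>ft. is_lift Y y0 Xt xt0 \<rho> f ft"
    then show "induced_map X f ` carrier (A1 Y y0) \<subseteq> induced_map X \<rho> ` carrier (A1 Xt xt0)"
      using lift_imp_incl[OF assms(2,1) iso assms(3) f] by blast
  next
    assume incl: "induced_map X f ` carrier (A1 Y y0) \<subseteq> induced_map X \<rho> ` carrier (A1 Xt xt0)"
    show "\<exists>ft. is_lift Y y0 Xt xt0 \<rho> f ft"
    proof (rule lift_of_loop_condition[OF assms(2,1) iso assms(3) f y0 assms(6,7) xt0])
      fix \<gamma>
      assume "path_between Y y0 y0 \<gamma>"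
      then show "\<exists>gt. path_between Xt xt0 xt0 gt \<and> \<rho> \<circ> gt = f \<circ> \<gamma>"
        by (rule loop_lifts_to_loop[OF assms(2,1) iso assms(9,10,3) f assms(7) xt0 incl]) blast
    qed
  qed
qed

end
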